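(* Let $P$ be a partially ordered set, let $i\in\{1,2,3\}$ and $C\subseteq P$. The following statements are equivalent: (i) $C$ is order closed. (ii) For every net $(x_\alpha)_{\alpha\in A}$ in $C$ and every $x\in P$ with $x_\alpha\xrightarrow{o_i}x$ (in $P$) it follows that $x\in C$.
   Context: Nets are indexed by non-empty upward directed partially ordered sets. For a net in a partially ordered set $P$, $x_\alpha\downarrow x$ means that $x_\alpha\le x_\beta$ whenever $\alpha\ge\beta$ and $\inf_\alpha x_\alpha=x$; $x_\alpha\uparrow x$ is defined dually. $A_{\ge\alpha_0}:=\{\alpha\in A;\ \alpha\ge\alpha_0\}$, and $[a,b]:=\{z\in P;\ a\le z\le b\}$. Order convergence in $P$, for a net $(x_\alpha)_{\alpha\in A}$ in $P$ and $x\in P$: - $x_\alpha\xrightarrow{o_1}x$ if there are nets $(\hat x_\alpha)_{\alpha\in A}$, $(\check x_\alpha)_{\alpha\in A}$ in $P$ with $\hat x_\alpha\uparrow x$, $\check x_\alpha\downarrow x$ and $\hat x_\alpha\le x_\alpha\le\check x_\alpha$ for all $\alpha\in A$. - $x_\alpha\xrightarrow{o_2}x$ if there are such nets $(\hat x_\alpha)_{\alpha\in A}$, $(\check x_\alpha)_{\alpha\in A}$ with $\hat x_\alpha\uparrow x$, $\check x_\alpha\downarrow x$, and $\alpha_0\in A$ with $\hat x_\alpha\le x_\alpha\le\check x_\alpha$ for all $\alpha\in A_{\ge\alpha_0}$. - $x_\alpha\xrightarrow{o_3}x$ if there are nets $(\hat x_\beta)_{\beta\in B}$, $(\check x_\gamma)_{\gamma\in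 C'}$ in $P$ and a map $\eta\colon B\times C'\to A$ with $\hat x_\beta\uparrow x$, $\check x_\gamma\downarrow x$ and $\hat x_\beta\le x_\alpha\le\check x_\gamma$ for all $\beta\in B$, $\gamma\in C'$, $\alpha\in A_{\ge\eta(\beta,\gamma)}$. $U\subseteq P$ is a net catching set for $x\in P$ if for all nets $(\hat x_\alpha)_{\alpha\in A}$, $(\check x_\alpha)_{\alpha\in A}$ in $P$ (same index set) with $\hat x_\alpha\uparrow x$ and $\check x_\alpha\downarrow x$ there is $\alpha\in A$ with $[\hat x_\alpha,\check x_\alpha]\subseteq U$. $O\subseteq P$ is order open if it is a net catching set for each of its points; $C\subseteq P$ is order closed if $P\setminus C$ is order open. *)

theory Defs
  imports "HOL-Library.Lub_Glb" "HOL-Library.FuncSet"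
begin

section \<open>Nets in a partially ordered set\<close>

text \<open>
  An index set is a carrier \<open>A\<close> with its order relation \<open>r\<close>, where \<open>(\<alpha>, \<beta>) \<in> r\<close> means
  \<open>\<alpha> \<le> \<beta>\<close>. A net is a function on the index type; only its values on \<open>A\<close> matter.
\<close>

definition directed_poset :: "'i set \<Rightarrow> ('i \<times> 'i) set \<Rightarrow> bool" where
  "directed_poset A r \<longleftrightarrow>
     A \<noteq> {} \<and> partial_order_on A r \<and>
     (\<forall>\<alpha>\<in>A. \<forall>\<beta>\<in>A. \<exists>\<gamma>\<in>A. (\<alpha>, \<gamma>) \<in> r \<and> (\<beta>, \<gamma>) \<in> r)"

definition net_up :: "'i set \<Rightarrow> ('i \<times> 'i) set \<Rightarrow> ('i \<Rightarrow> 'a::order) \<Rightarrow> 'a \<Rightarrow> bool" where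
  "net_up A r x p \<longleftrightarrow>
     (\<forall>\<alpha>\<in>A. \<forall>\<beta>\<in>A. (\<beta>, \<alpha>) \<in> r \<longrightarrow> x \<beta> \<le> x \<alpha>) \<and> isLub UNIV (x ` A) p"

definition net_down :: "'i set \<Rightarrow> ('i \<times> 'i) set \<Rightarrow> ('i \<Rightarrow> 'a::order) \<Rightarrow> 'a \<Rightarrow> bool" where
  "net_down A r x p \<longleftrightarrow>
     (\<forall>\<alpha>\<in>A. \<forall>\<beta>\<in>A. (\<beta>, \<alpha>) \<in> r \<longrightarrow> x \<alpha> \<le> x \<beta>) \<and> isGlb UNIV (x ` A) p"

section \<open>Order convergence\<close>

definition o1_conv :: "'i set \<Rightarrow> ('i \<times> 'i) set \<Rightarrow> ('i \<Rightarrow> 'a::order) \<Rightarrow> 'a \<Rightarrow> bool" where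
  "o1_conv A r x p \<longleftrightarrow>
     (\<exists>l u. net_up A r l p \<and> net_down A r u p \<and> (\<forall>\<alpha>\<in>A. l \<alpha> \<le> x \<alpha> \<and> x \<alpha> \<le> u \<alpha>))"

definition o2_conv :: "'i set \<Rightarrow> ('i \<times> 'i) set \<Rightarrow> ('i \<Rightarrow> 'a::order) \<Rightarrow> 'a \<Rightarrow> bool" where
  "o2_conv A r x p \<longleftrightarrow>
     (\<exists>l u. net_up A r l p \<and> net_down A r u p \<and>
        (\<exists>\<alpha>\<^sub>0\<in>A. \<forall>\<alpha>\<in>A. (\<alpha>\<^sub>0, \<alpha>) \<in> r \<longrightarrow> l \<alpha> \<le> x \<alpha> \<and> x \<alpha> \<le> u \<alpha>))"

text \<open>
  The index sets \<open>B\<close>, \<open>C\<close> range over the same type as \<open>A\<close>; \<open>o3_convI\<close> below shows that index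
  sets from other types give nothing more once that type is large enough.
\<close>

definition o3_conv :: "'i set \<Rightarrow> ('i \<times> 'i) set \<Rightarrow> ('i \<Rightarrow> 'a::order) \<Rightarrow> 'a \<Rightarrow> bool" where
  "o3_conv A r x p \<longleftrightarrow>
     (\<exists>(B :: 'i set) s (C :: 'i set) t l u.
        directed_poset B s \<and> directed_poset C t \<and> net_up B s l p \<and> net_down C t u p \<and>
        (\<exists>\<eta> \<in> B \<times> C \<rightarrow> A. \<forall>\<beta>\<in>B. \<forall>\<gamma>\<in>C. \<forall>\<alpha>\<in>A.
           (\<eta> (\<beta>, \<gamma>), \<alpha>) \<in> r \<longrightarrow> l \<beta> \<le> x \<alpha> \<and> x \<alpha> \<le> u \<gamma>))"

text \<open>Only the indices \<open>1\<close>, \<open>2\<close>, \<open>3\<close> are meaningful.\<close>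

definition order_conv ::
    "nat \<Rightarrow> 'i set \<Rightarrow> ('i \<times> 'i) set \<Rightarrow> ('i \<Rightarrow> 'a::order) \<Rightarrow> 'a \<Rightarrow> bool" where
  "order_conv i = (if i = 1 then o1_conv else if i = 2 then o2_conv else o3_conv)"

section \<open>Order closed sets\<close>

text \<open>
  HOL cannot quantify over all index types inside a definition, so the type from which index
  sets are taken is an explicit parameter.
\<close>

definition net_catching :: "'i itself \<Rightarrow> 'a::order set \<Rightarrow> 'a \<Rightarrow> bool" where
  "net_catching _ U p \<longleftrightarrow>
     (\<forall>(A :: 'i set) r l u.
        directed_poset A r \<longrightarrow> net_up A r l p \<longrightarrow> net_down A r u p \<longrightarrow>
        (\<exists>\<alpha>\<in>A. {l \<alpha>..u \<alpha>} \<subseteq> U))"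

definition order_open :: "'i itself \<Rightarrow> 'a::order set \<Rightarrow> bool" where
  "order_open I O' \<longleftrightarrow> (\<forall>p\<in>O'. net_catching I O' p)"

definition order_closed :: "'i itself \<Rightarrow> 'a::order set \<Rightarrow> bool" where
  "order_closed I C \<longleftrightarrow> order_open I (- C)"

section \<open>Independence of the index type\<close>

text \<open>
  For nets in \<open>'a\<close> the index type \<open>('a, 'u) index\<close> is large enough, for any \<open>'u\<close>: the notions
  above then mean the same as with index sets from arbitrary types, as the lemmas below show.
  Every directed set of any type \<open>'u\<close> also occurs, as a copy under \<open>Inr\<close>, in \<open>('a, 'u) index\<close>,
  so a statement for all \<open>'u\<close> about index sets in \<open>('a, 'u) index\<close> covers all index sets.
\<close>

type_synonym ('a, 'u) index = "'a \<times> 'a + 'u"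

lemma directed_poset_image:
  fixes f :: "'j \<Rightarrow> 'k" and e :: "'k \<Rightarrow> 'i"
  assumes A: "directed_poset A r" and e: "inj e"
    and mono: "\<And>a b. a \<in> A \<Longrightarrow> b \<in> A \<Longrightarrow> (a, b) \<in> r \<Longrightarrow> le (f a) (f b)"
    and refl: "\<And>y. le y y"
    and trans: "\<And>y z w. le y z \<Longrightarrow> le z w \<Longrightarrow> le y w"
    and antisym: "\<And>y z. le y z \<Longrightarrow> le z y \<Longrightarrow> y = z"
  shows "directed_poset (e ` f ` A) {(e y, e z) | y z. y \<in> f ` A \<and> z \<in> f ` A \<and> le y z}"
    (is "directed_poset ?K ?R")
proof -
  have "trans ?R"
  proof (rule transI)
    fix a b c assume "(a, b) \<in> ?R" "(b, c) \<in> ?R"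
    then obtain y z z' w where yz: "a = e y" "b = e z" "y \<in> f ` A" "le y z"
      and zw: "b = e z'" "c = e w" "w \<in> f ` A" "le z' w"
      by blast
    have "z' = z" using yz(2) zw(1) injD[OF e] by metis
    then show "(a, c) \<in> ?R" using yz zw trans[of y z w] by blast
  qed
  moreover have "antisym ?R"
  proof (rule antisymI)
    fix a b assume "(a, b) \<in> ?R" "(b, a) \<in> ?R"
    then obtain y z z' y' where yz: "a = e y" "b = e z" "le y z"
      and zy: "b = e z'" "a = e y'" "le z' y'"
      by blast
    have "z' = z" "y' = y" using yz(1,2) zy(1,2) injD[OF e] by metis+
    then show "a = b" using yz zy antisym[of y z] by simp
  qed
  moreover have "?R \<subseteq> ?K \<times> ?K"
    by blast
  moreover have "refl_on ?K ?R"
  proof (rule refl_onI)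
    fix a assume "a \<in> ?K"
    then obtain y where "a = e y" "y \<in> f ` A" by blast
    then show "(a, a) \<in> ?R" using refl[of y] by blast
  qed
  moreover have "?K \<noteq> {}"
    using A by (simp add: directed_poset_def)
  moreover have "\<forall>a\<in>?K. \<forall>b\<in>?K. \<exists>c\<in>?K. (a, c) \<in> ?R \<and> (b, c) \<in> ?R"
  proof (intro ballI)
    fix a b assume ab: "a \<in> ?K" "b \<in> ?K"
    obtain a' where a': "a' \<in> A" "a = e (f a')" using ab(1) by blast
    obtain b' where b': "b' \<in> A" "b = e (f b')" using ab(2) by blast
    obtain c' where c': "c' \<in> A" "(a', c') \<in> r" "(b', c') \<in> r"
      using A a'(1) b'(1) unfolding directed_poset_def by blast
    have "(a, e (f c')) \<in> ?R" "(b, e (f c')) \<in> ?R"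
      using a' b' c'(1) mono[OF a'(1) c'(1,2)] mono[OF b'(1) c'(1,3)] by auto
    then show "\<exists>c\<in>?K. (a, c) \<in> ?R \<and> (b, c) \<in> ?R"
      using c'(1) by (intro bexI[of _ "e (f c')"] conjI imageI)
  qed
  ultimately show ?thesis
    unfolding directed_poset_def partial_order_on_def preorder_on_def by (intro conjI)
qed

lemma net_catchingD:
  fixes A :: "'j set" and U :: "'a::order set"
  assumes U: "net_catching TYPE(('a, 'u) index) U p"
    and A: "directed_poset A r" and l: "net_up A r l p" and u: "net_down A r u p"
  shows "\<exists>\<alpha>\<in>A. {l \<alpha>..u \<alpha>} \<subseteq> U"
proof -
  define e :: "'a \<times> 'a \<Rightarrow> ('a, 'u) index" where "e = Inl"
  define f where "f = (\<lambda>\<alpha>. (l \<alpha>, u \<alpha>))"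
  define le where "le = (\<lambda>y z :: 'a \<times> 'a. fst y \<le> fst z \<and> snd z \<le> snd y)"
  define R where "R = {(e y, e z) | y z. y \<in> f ` A \<and> z \<in> f ` A \<and> le y z}"
  have e: "inj e" by (simp add: e_def)
  have "directed_poset (e ` f ` A) R"
    unfolding R_def
  proof (rule directed_poset_image[OF A e])
    show "le (f a) (f b)" if "a \<in> A" "b \<in> A" "(a, b) \<in> r" for a b
      using l u that by (auto simp: le_def f_def net_up_def net_down_def)
  qed (auto simp: le_def prod_eq_iff)
  moreover have "net_up (e ` f ` A) R (fst \<circ> inv e) p"
    using l unfolding net_up_def R_def
    by (auto simp: image_image f_def le_def inv_f_f[OF e] inj_eq[OF e])
  moreover have "net_down (e ` f ` A) R (snd \<circ> inv e) p"
    using u unfolding net_down_def R_def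
    by (auto simp: image_image f_def le_def inv_f_f[OF e] inj_eq[OF e])
  ultimately have "\<exists>\<kappa>\<in>e ` f ` A. {(fst \<circ> inv e) \<kappa>..(snd \<circ> inv e) \<kappa>} \<subseteq> U"
    using U unfolding net_catching_def by blast
  then obtain \<alpha> where "\<alpha> \<in> A"
      "{(fst \<circ> inv e) (e (f \<alpha>))..(snd \<circ> inv e) (e (f \<alpha>))} \<subseteq> U"
    by blast
  then show ?thesis
    unfolding comp_apply inv_f_f[OF e] unfolding f_def fst_conv snd_conv by blast
qed

lemma net_catching_index_type:
  "net_catching TYPE(('a, 'u) index) (U :: 'a::order set) p \<longleftrightarrow>
   net_catching TYPE(('a, 'v) index) U p"
proof
  show "net_catching TYPE(('a, 'v) index) U p" if "net_catching TYPE(('a, 'u) index) U p"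
    unfolding net_catching_def using net_catchingD[OF that] by blast
  show "net_catching TYPE(('a, 'u) index) U p" if "net_catching TYPE(('a, 'v) index) U p"
    unfolding net_catching_def using net_catchingD[OF that] by blast
qed

lemma order_closed_index_type:
  "order_closed TYPE(('a, 'u) index) (C :: 'a::order set) \<longleftrightarrow>
   order_closed TYPE(('a, 'v) index) C"
  unfolding order_closed_def order_open_def
  by (simp add: net_catching_index_type[where 'u = 'u and 'v = 'v])

lemma o3_convI:
  fixes A :: "('a::order, 'u) index set" and B :: "'b set" and C :: "'c set"
    and x :: "('a, 'u) index \<Rightarrow> 'a"
  assumes B: "directed_poset B s" and C: "directed_poset C t"
    and l: "net_up B s l p" and u: "net_down C t u p"
    and \<eta>: "\<eta> \<in> B \<times> C \<rightarrow> A"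
    and le: "\<And>\<beta> \<gamma> \<alpha>. \<beta> \<in> B \<Longrightarrow> \<gamma> \<in> C \<Longrightarrow> \<alpha> \<in> A \<Longrightarrow> (\<eta> (\<beta>, \<gamma>), \<alpha>) \<in> r \<Longrightarrow>
               l \<beta> \<le> x \<alpha> \<and> x \<alpha> \<le> u \<gamma>"
  shows "o3_conv A r x p"
proof -
  define e :: "'a \<Rightarrow> ('a, 'u) index" where "e = (\<lambda>a. Inl (a, a))"
  have e: "inj e" by (auto simp: e_def inj_def)
  define S where "S = {(e y, e z) | y z. y \<in> l ` B \<and> z \<in> l ` B \<and> y \<le> z}"
  define T where "T = {(e y, e z) | y z. y \<in> u ` C \<and> z \<in> u ` C \<and> y \<ge> z}"
  have S: "directed_poset (e ` l ` B) S"
    unfolding S_def using l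
    by (intro directed_poset_image[OF B e]) (auto simp: net_up_def)
  have T: "directed_poset (e ` u ` C) T"
    unfolding T_def using u
    by (intro directed_poset_image[OF C e]) (auto simp: net_down_def)
  have l': "net_up (e ` l ` B) S (inv e) p"
    using l unfolding net_up_def S_def
    by (auto simp: image_image inv_f_f[OF e] inj_eq[OF e])
  have u': "net_down (e ` u ` C) T (inv e) p"
    using u unfolding net_down_def T_def
    by (auto simp: image_image inv_f_f[OF e] inj_eq[OF e])
  define \<eta>' where "\<eta>' = (\<lambda>(y, z). \<eta> (inv_into B (e \<circ> l) y, inv_into C (e \<circ> u) z))"
  have inv: "inv_into B (e \<circ> l) y \<in> B" "l (inv_into B (e \<circ> l) y) = inv e y"
    if "y \<in> e ` l ` B" for y
  proof -
    have y: "y \<in> (e \<circ> l) ` B" using that by (simp add: image_comp)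
    show "inv_into B (e \<circ> l) y \<in> B" by (rule inv_into_into[OF y])
    show "l (inv_into B (e \<circ> l) y) = inv e y"
      using f_inv_into_f[OF y] e by (metis comp_apply inv_f_f)
  qed
  have inv': "inv_into C (e \<circ> u) z \<in> C" "u (inv_into C (e \<circ> u) z) = inv e z"
    if "z \<in> e ` u ` C" for z
  proof -
    have z: "z \<in> (e \<circ> u) ` C" using that by (simp add: image_comp)
    show "inv_into C (e \<circ> u) z \<in> C" by (rule inv_into_into[OF z])
    show "u (inv_into C (e \<circ> u) z) = inv e z"
      using f_inv_into_f[OF z] e by (metis comp_apply inv_f_f)
  qed
  have \<eta>': "\<eta>' \<in> e ` l ` B \<times> e ` u ` C \<rightarrow> A"
  proof (rule Pi_I)
    fix w assume "w \<in> e ` l ` B \<times> e ` u ` C"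
    then obtain y z where w: "w = (y, z)" "y \<in> e ` l ` B" "z \<in> e ` u ` C"
      by (rule SigmaE) simp
    show "\<eta>' w \<in> A"
      unfolding w(1) \<eta>'_def prod.case
      by (rule Pi_mem[OF \<eta>]) (intro SigmaI inv(1)[OF w(2)] inv'(1)[OF w(3)])
  qed
  have le': "inv e y \<le> x \<alpha> \<and> x \<alpha> \<le> inv e z"
    if "y \<in> e ` l ` B" "z \<in> e ` u ` C" "\<alpha> \<in> A" "(\<eta>' (y, z), \<alpha>) \<in> r" for y z \<alpha>
    using le[OF inv(1)[OF that(1)] inv'(1)[OF that(2)] that(3)] that(4)
    by (simp add: \<eta>'_def inv(2)[OF that(1)] inv'(2)[OF that(2)])
  show ?thesis
    unfolding o3_conv_def
    by (rule exI[of _ "e ` l ` B"], rule exI[of _ S], rule exI[of _ "e ` u ` C"],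
        rule exI[of _ T], rule exI[of _ "inv e"], rule exI[of _ "inv e"])
      (intro conjI bexI[OF _ \<eta>'] ballI impI S T l' u'; drule (3) le'; simp)
qed

end

(* If C is not order closed, an interval net witnessing this meets C at every index, and any
   choice of points there is a net in C with o1-limit outside C. Conversely, each of o1, o2
   implies o3, and for an o3-limit p the bounding nets, re-indexed over the product of their
   index sets, trap p: if p were not in C, an interval [l \<beta>, u \<gamma>] would miss C although it
   contains a tail of the net. *)
theory Submission
  imports Defs
begin

lemma directed_poset_refl: "directed_poset A r \<Longrightarrow> \<alpha> \<in> A \<Longrightarrow> (\<alpha>, \<alpha>) \<in> r"
  by (simp add: directed_poset_def partial_order_on_def preorder_on_def refl_on_def)

lemma directed_poset_trans:
  "directed_poset A r \<Longrightarrow> (\<alpha>, \<beta>) \<in> r \<Longrightarrow> (\<beta>, \<gamma>) \<in> r \<Longrightarrow> (\<alpha>, \<gamma>) \<in> r"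
  unfolding directed_poset_def partial_order_on_def preorder_on_def by (blast dest: transD)

text \<open>The two bounding nets of an o3-limit have unrelated index sets, whereas net catching
  speaks of two nets over one index set. The componentwise order on the product supplies a common
  one; upper bounds are found in each factor separately.\<close>

lemma directed_poset_prod:
  assumes "directed_poset B s" and "directed_poset C t"
  shows "directed_poset (B \<times> C) {((b, c), (b', c')) | b c b' c'. (b, b') \<in> s \<and> (c, c') \<in> t}"
    (is "directed_poset _ ?R")
proof -
  have po: "partial_order_on B s" "partial_order_on C t"
    using assms by (simp_all add: directed_poset_def)
  have "trans ?R"
    using assms by (auto intro!: transI elim: directed_poset_trans)
  moreover have "antisym ?R"
    using po by (auto intro!: antisymI simp: partial_order_on_def dest: antisymD)
  moreover have "refl_on (B \<times> C) ?R" "?R \<subseteq> (B \<times> C) \<times> (B \<times> C)"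
    using po by (auto simp: partial_order_on_def preorder_on_def refl_on_def)
  moreover have "B \<times> C \<noteq> {}"
    using assms by (simp add: directed_poset_def)
  moreover have "\<forall>a\<in>B \<times> C. \<forall>b\<in>B \<times> C. \<exists>c\<in>B \<times> C. (a, c) \<in> ?R \<and> (b, c) \<in> ?R"
  proof clarify
    fix b c b' c' assume *: "b \<in> B" "c \<in> C" "b' \<in> B" "c' \<in> C"
    obtain b'' where "b'' \<in> B" "(b, b'') \<in> s" "(b', b'') \<in> s"
      using assms(1) * unfolding directed_poset_def by blast
    moreover obtain c'' where "c'' \<in> C" "(c, c'') \<in> t" "(c', c'') \<in> t"
      using assms(2) * unfolding directed_poset_def by blast
    ultimately show "\<exists>d\<in>B \<times> C. ((b, c), d) \<in> ?R \<and> ((b', c'), d) \<in> ?R"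
      by (intro bexI[of _ "(b'', c'')"]) auto
  qed
  ultimately show ?thesis
    unfolding directed_poset_def partial_order_on_def preorder_on_def by (intro conjI)
qed

lemma o1_conv_imp_o2_conv:
  assumes "directed_poset A r" and "o1_conv A r x p"
  shows "o2_conv A r x p"
proof -
  obtain \<alpha>\<^sub>0 where "\<alpha>\<^sub>0 \<in> A"
    using assms(1) by (auto simp: directed_poset_def)
  then show ?thesis
    using assms(2) unfolding o1_conv_def o2_conv_def by blast
qed

text \<open>Both bounding nets keep the index set \<open>A\<close>, and \<eta> sends (\<beta>,
  \<gamma>) to a common upper bound of \<beta>, \<gamma> and the threshold
  \<open>\<alpha>\<^sub>0\<close>. Beyond it the o2 bounds at \<alpha> hold, and monotonicity
  weakens them to the bounds at \<beta> and \<gamma>.\<close>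

lemma o2_conv_imp_o3_conv:
  assumes A: "directed_poset A r" and "o2_conv A r x p"
  shows "o3_conv A r x p"
proof -
  obtain l u \<alpha>\<^sub>0 where l: "net_up A r l p" and u: "net_down A r u p" and \<alpha>\<^sub>0: "\<alpha>\<^sub>0 \<in> A"
    and le: "\<And>\<alpha>. \<alpha> \<in> A \<Longrightarrow> (\<alpha>\<^sub>0, \<alpha>) \<in> r \<Longrightarrow> l \<alpha> \<le> x \<alpha> \<and> x \<alpha> \<le> u \<alpha>"
    using assms(2) unfolding o2_conv_def by blast
  have "\<exists>\<delta>\<in>A. (\<beta>, \<delta>) \<in> r \<and> (\<gamma>, \<delta>) \<in> r \<and> (\<alpha>\<^sub>0, \<delta>) \<in> r" if "\<beta> \<in> A" "\<gamma> \<in> A" for \<beta> \<gamma>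
  proof -
    obtain \<epsilon> where \<epsilon>: "\<epsilon> \<in> A" "(\<beta>, \<epsilon>) \<in> r" "(\<gamma>, \<epsilon>) \<in> r"
      using A \<open>\<beta> \<in> A\<close> \<open>\<gamma> \<in> A\<close> unfolding directed_poset_def by blast
    then obtain \<delta> where "\<delta> \<in> A" "(\<epsilon>, \<delta>) \<in> r" "(\<alpha>\<^sub>0, \<delta>) \<in> r"
      using A \<alpha>\<^sub>0 unfolding directed_poset_def by blast
    then show ?thesis
      using \<epsilon> directed_poset_trans[OF A] by blast
  qed
  \<comment> \<open>Membership is moved under the existential so that the axiom of choice applies to
    all \<beta>, \<gamma> and yields one function \<open>h\<close>.\<close>
  then have "\<forall>\<beta> \<gamma>. \<exists>\<delta>. \<beta> \<in> A \<longrightarrow> \<gamma> \<in> A \<longrightarrow>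
      \<delta> \<in> A \<and> (\<beta>, \<delta>) \<in> r \<and> (\<gamma>, \<delta>) \<in> r \<and> (\<alpha>\<^sub>0, \<delta>) \<in> r"
    by blast
  then obtain h where h: "h \<beta> \<gamma> \<in> A" "(\<beta>, h \<beta> \<gamma>) \<in> r" "(\<gamma>, h \<beta> \<gamma>) \<in> r" "(\<alpha>\<^sub>0, h \<beta> \<gamma>) \<in> r"
    if "\<beta> \<in> A" "\<gamma> \<in> A" for \<beta> \<gamma>
    unfolding choice_iff by blast
  have "l \<beta> \<le> x \<alpha> \<and> x \<alpha> \<le> u \<gamma>"
    if "\<beta> \<in> A" "\<gamma> \<in> A" "\<alpha> \<in> A" "(h \<beta> \<gamma>, \<alpha>) \<in> r" for \<alpha> \<beta> \<gamma>
  proof -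
    have "(\<beta>, \<alpha>) \<in> r" "(\<gamma>, \<alpha>) \<in> r" "(\<alpha>\<^sub>0, \<alpha>) \<in> r"
      using h[OF that(1,2)] that(4) directed_poset_trans[OF A] by blast+
    then have "l \<beta> \<le> l \<alpha>" "u \<alpha> \<le> u \<gamma>" "l \<alpha> \<le> x \<alpha>" "x \<alpha> \<le> u \<alpha>"
      using l u le that by (auto simp: net_up_def net_down_def)
    then show ?thesis
      by (blast intro: order_trans)
  qed
  moreover have "(\<lambda>(\<beta>, \<gamma>). h \<beta> \<gamma>) \<in> A \<times> A \<rightarrow> A"
    using h(1) by auto
  ultimately have "\<exists>\<eta> \<in> A \<times> A \<rightarrow> A. \<forall>\<beta>\<in>A. \<forall>\<gamma>\<in>A. \<forall>\<alpha>\<in>A.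
      (\<eta> (\<beta>, \<gamma>), \<alpha>) \<in> r \<longrightarrow> l \<beta> \<le> x \<alpha> \<and> x \<alpha> \<le> u \<gamma>"
    by (intro bexI[of _ "\<lambda>(\<beta>, \<gamma>). h \<beta> \<gamma>"]) auto
  then show ?thesis
    using A l u unfolding o3_conv_def by blast
qed

text \<open>o1 is the strongest of the three modes and o3 the weakest. Hence closure under o1-limits
  suffices for order closedness, and only o3-limits have to be treated in the converse, uniformly in
  \<open>i\<close>.\<close>

lemma o1_conv_imp_order_conv:
  assumes "directed_poset A r" and "o1_conv A r x p"
  shows "order_conv i A r x p"
  using assms by (simp add: order_conv_def o1_conv_imp_o2_conv o2_conv_imp_o3_conv)

lemma order_conv_imp_o3_conv:
  assumes "directed_poset A r" and "order_conv i A r x p"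
  shows "o3_conv A r x p"
  using assms
  by (auto simp: order_conv_def o1_conv_imp_o2_conv o2_conv_imp_o3_conv split: if_splits)

lemma order_closed_o3_convD:
  fixes A :: "'i set" and C :: "'a::order set"
  assumes C: "order_closed TYPE(('a, 'u) index) C"
    and A: "directed_poset A r" and x: "\<And>\<alpha>. \<alpha> \<in> A \<Longrightarrow> x \<alpha> \<in> C"
    and conv: "o3_conv A r x p"
  shows "p \<in> C"
proof (rule ccontr)
  assume "p \<notin> C"
  then have catching: "net_catching TYPE(('a, 'u) index) (- C) p"
    using C by (simp add: order_closed_def order_open_def)
  obtain B D :: "'i set" and s t l u \<eta>
    where B: "directed_poset B s" and D: "directed_poset D t"
      and l: "net_up B s l p" and u: "net_down D t u p" and \<eta>: "\<eta> \<in> B \<times> D \<rightarrow> A"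
      and le: "\<And>\<beta> \<gamma> \<alpha>. \<beta> \<in> B \<Longrightarrow> \<gamma> \<in> D \<Longrightarrow> \<alpha> \<in> A \<Longrightarrow> (\<eta> (\<beta>, \<gamma>), \<alpha>) \<in> r \<Longrightarrow>
        l \<beta> \<le> x \<alpha> \<and> x \<alpha> \<le> u \<gamma>"
    using conv unfolding o3_conv_def by blast
  define R where "R = {((b, d), (b', d')) | b d b' d'. (b, b') \<in> s \<and> (d, d') \<in> t}"
  have R: "directed_poset (B \<times> D) R"
    unfolding R_def by (rule directed_poset_prod[OF B D])
  \<comment> \<open>As neither factor is empty, composing with a projection leaves the range
    unchanged, and with it the supremum and the infimum \<open>p\<close>.\<close>
  have "(l \<circ> fst) ` (B \<times> D) = l ` B" "(u \<circ> snd) ` (B \<times> D) = u ` D"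
    using B D by (simp_all add: directed_poset_def flip: image_image image_comp)
  then have "net_up (B \<times> D) R (l \<circ> fst) p" "net_down (B \<times> D) R (u \<circ> snd) p"
    using l u by (auto simp: net_up_def net_down_def R_def)
  \<comment> \<open>The product is indexed by pairs over \<open>'i\<close>, not by the type in
    \<open>catching\<close>; \<open>net_catchingD\<close> bridges this gap.\<close>
  then obtain \<beta> \<gamma> where \<beta>\<gamma>: "\<beta> \<in> B" "\<gamma> \<in> D" "{l \<beta>..u \<gamma>} \<subseteq> - C"
    using net_catchingD[OF catching R] by fastforce
  \<comment> \<open>By reflexivity this index lies in its own tail, so the value of \<open>x\<close>
    there is in the interval, hence outside \<open>C\<close>, although \<open>x\<close> is a net in
    \<open>C\<close>.\<close>
  have "\<eta> (\<beta>, \<gamma>) \<in> A"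
    using \<eta> \<beta>\<gamma> by blast
  then show False
    using le[OF \<beta>\<gamma>(1,2)] directed_poset_refl[OF A] x \<beta>\<gamma>(3) by fastforce
qed

text \<open>The net built from a failure of net catching reuses the index set of the two given nets,
  so the argument stays within an arbitrary index type \<open>'i\<close>.\<close>

lemma order_closedI_o1_conv:
  fixes C :: "'a::order set"
  assumes closed: "\<And>(A :: 'i set) r x p. directed_poset A r \<Longrightarrow> (\<And>\<alpha>. \<alpha> \<in> A \<Longrightarrow> x \<alpha> \<in> C) \<Longrightarrow>
    o1_conv A r x p \<Longrightarrow> p \<in> C"
  shows "order_closed TYPE('i) C"
  unfolding order_closed_def order_open_def net_catching_def
proof (intro ballI allI impI, rule ccontr)
  fix p and A :: "'i set" and r l u
  assume p: "p \<in> - C" and A: "directed_poset A r"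
    and l: "net_up A r l p" and u: "net_down A r u p"
    and "\<not> (\<exists>\<alpha>\<in>A. {l \<alpha>..u \<alpha>} \<subseteq> - C)"
  then have "\<forall>\<alpha>\<in>A. \<exists>y. y \<in> C \<and> l \<alpha> \<le> y \<and> y \<le> u \<alpha>"
    by fastforce
  then obtain x where x: "\<forall>\<alpha>\<in>A. x \<alpha> \<in> C \<and> l \<alpha> \<le> x \<alpha> \<and> x \<alpha> \<le> u \<alpha>"
    by metis
  \<comment> \<open>The given nets \<open>l\<close> and \<open>u\<close> themselves serve as the
    bounds, at every index.\<close>
  then have "o1_conv A r x p"
    using l u unfolding o1_conv_def by blast
  then show False
    using closed[OF A] x p by blast
qed

theorem theorem3p14:
  fixes C :: "'a::order set" and i :: nat
  assumes "i \<in> {1, 2, 3}"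
  shows "order_closed TYPE(('a, 'u) index) C \<longleftrightarrow>
    (\<forall>(A :: ('a, 'u) index set) r x p.
       directed_poset A r \<longrightarrow> (\<forall>\<alpha>\<in>A. x \<alpha> \<in> C) \<longrightarrow> order_conv i A r x p \<longrightarrow> p \<in> C)"
    (is "?closed \<longleftrightarrow> ?seq")
proof
  show ?seq if ?closed
    using order_closed_o3_convD[OF that] order_conv_imp_o3_conv by blast
  show ?closed if ?seq
    by (rule order_closedI_o1_conv) (use that o1_conv_imp_order_conv in blast)
qed

end
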